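(* Let $(S,A)$ be a computable physical model. If $S$ is infinite, then $(S,A)$ is isomorphic to some computable physical model whose set of states is the set of all non-negative integers. If $S$ has exactly $n$ elements, then $(S,A)$ is isomorphic to some computable physical model whose set of states is $\{0,1,\dots,n-1\}$.
   Context: A computable physical model is a pair $(S,A)$ where $S$ (the set of states) is a recursive set of non-negative integers and $A$ (the set of observable quantities) is a set of total recursive functions from the non-negative integers to the non-negative integers. Two physical models $(S,A)$ and $(T,B)$ are isomorphic iff there exist bijections $\phi:S\to T$ and $\psi:A\to B$ such that $\alpha(s)=\psi(\alpha)(\phi(s))$ for all $s\in S$ and $\alpha\in A$.
   Formalization: For infinite S the claim fails if distinct observables agree on all of S (S = positive integers, A = {0, indicator of 0}); so (S,A) is shown isomorphic when distinct observables differ on S, and in general with each observable replaced by its restriction to S. *)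

theory Defs
  imports "HOL-Library.FuncSet"
begin

text \<open>
  Kleene's partial recursive functions, given by terms. \<open>Zero\<close> is the constant zero function of
  every arity, including zero; \<open>PrimRec\<close> recurses on the first argument; \<open>Mu\<close> searches over an
  additional first argument.
\<close>

datatype recf =
    Zero
  | Succ
  | Proj nat
  | Comp recf "recf list"
  | PrimRec recf recf
  | Mu recf

fun has_arity :: "nat \<Rightarrow> recf \<Rightarrow> bool" where
  "has_arity k Zero \<longleftrightarrow> True"
| "has_arity k Succ \<longleftrightarrow> k = 1"
| "has_arity k (Proj i) \<longleftrightarrow> i < k"
| "has_arity k (Comp f gs) \<longleftrightarrow> has_arity (length gs) f \<and> (\<forall>g\<in>set gs. has_arity k g)"
| "has_arity k (PrimRec f g) \<longleftrightarrow> k > 0 \<and> has_arity (k - 1) f \<and> has_arity (k + 1) g"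
| "has_arity k (Mu f) \<longleftrightarrow> has_arity (k + 1) f"

text \<open>
  \<open>None\<close> stands for divergence. The value is only meaningful when the term has arity
  \<open>length xs\<close>. Minimisation requires convergence at all arguments below the first zero.
\<close>

fun eval :: "recf \<Rightarrow> nat list \<Rightarrow> nat option" where
  "eval Zero xs = Some 0"
| "eval Succ xs = Some (Suc (hd xs))"
| "eval (Proj i) xs = Some (xs ! i)"
| "eval (Comp f gs) xs =
     (if \<forall>g\<in>set gs. eval g xs \<noteq> None then eval f (map (\<lambda>g. the (eval g xs)) gs) else None)"
| "eval (PrimRec f g) xs =
     rec_nat (eval f (tl xs)) (\<lambda>m r. Option.bind r (\<lambda>y. eval g (m # y # tl xs))) (hd xs)"
| "eval (Mu f) xs =
     (if \<exists>z. eval f (z # xs) = Some 0 \<and> (\<forall>y<z. eval f (y # xs) \<noteq> None)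
      then Some (LEAST z. eval f (z # xs) = Some 0) else None)"

definition total_recursive :: "(nat \<Rightarrow> nat) \<Rightarrow> bool" where
  "total_recursive f \<longleftrightarrow> (\<exists>p. has_arity 1 p \<and> (\<forall>x. eval p [x] = Some (f x)))"

definition recursive_set :: "nat set \<Rightarrow> bool" where
  "recursive_set S \<longleftrightarrow> total_recursive (\<lambda>x. if x \<in> S then 1 else 0)"

type_synonym 's model = "'s set \<times> ('s \<Rightarrow> nat) set"

fun computable_physical_model :: "nat model \<Rightarrow> bool" where
  "computable_physical_model (S, A) \<longleftrightarrow> recursive_set S \<and> (\<forall>\<alpha>\<in>A. total_recursive \<alpha>)"

fun isomorphic :: "'s model \<Rightarrow> 't model \<Rightarrow> bool" where
  "isomorphic (S, A) (T, B) \<longleftrightarrow>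
     (\<exists>\<phi> \<psi>. bij_betw \<phi> S T \<and> bij_betw \<psi> A B \<and> (\<forall>s\<in>S. \<forall>\<alpha>\<in>A. \<alpha> s = \<psi> \<alpha> (\<phi> s)))"

text \<open>
  Observables are functions on all of \<open>nat\<close>, so two different ones may agree on every state. Such a
  model is not isomorphic to any model whose state set is \<open>UNIV\<close>, although the model that has the
  restrictions to \<open>S\<close> as its observables can be.
\<close>

abbreviation observables_on :: "'s set \<Rightarrow> ('s \<Rightarrow> nat) set \<Rightarrow> ('s \<Rightarrow> nat) set" where
  "observables_on S A \<equiv> (\<lambda>\<alpha>. restrict \<alpha> S) ` A"

abbreviation separated_by_states :: "'s set \<Rightarrow> ('s \<Rightarrow> nat) set \<Rightarrow> bool" where
  "separated_by_states S A \<equiv> inj_on (\<lambda>\<alpha>. restrict \<alpha> S) A"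

lemma isomorphic_UNIV_imp_separated:
  assumes "isomorphic (S, A) (UNIV, B)"
  shows "separated_by_states S A"
proof (rule inj_onI)
  obtain \<phi> \<psi> where iso: "bij_betw \<phi> S UNIV" "bij_betw \<psi> A B"
    "\<forall>s\<in>S. \<forall>\<alpha>\<in>A. \<alpha> s = \<psi> \<alpha> (\<phi> s)"
    using assms by auto
  fix \<alpha> \<beta> assume A: "\<alpha> \<in> A" "\<beta> \<in> A" and eq: "restrict \<alpha> S = restrict \<beta> S"
  have "\<psi> \<alpha> t = \<psi> \<beta> t" for t
  proof -
    obtain s where "s \<in> S" "t = \<phi> s"
      using bij_betw_imp_surj_on[OF iso(1)] by blast
    then show ?thesis
      using iso(3) A eq by (metis restrict_apply')
  qed
  then show "\<alpha> = \<beta>"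
    using bij_betw_imp_inj_on[OF iso(2)] A by (auto dest: inj_onD)
qed

lemma isomorphic_observables_on:
  assumes "separated_by_states S A"
  shows "isomorphic (S, A) (S, observables_on S A)"
  using inj_on_imp_bij_betw[OF assms] bij_betw_id[of S] by (fastforce simp: id_def)

text \<open>A computable physical model with infinitely many states whose observables are not separated.\<close>

lemma not_isomorphic_UNIV:
  defines "S \<equiv> {0<..} :: nat set"
    and "A \<equiv> {\<lambda>x. 0, \<lambda>x. if x = 0 then 1 else 0} :: (nat \<Rightarrow> nat) set"
  shows "computable_physical_model (S, A) \<and> infinite S \<and> (\<nexists>B. isomorphic (S, A) (UNIV, B))"
proof (intro conjI)
  have zero: "total_recursive (\<lambda>x. 0)"
    unfolding total_recursive_def by (rule exI[of _ Zero]) simp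
  have test: "total_recursive (\<lambda>x. if x = 0 then 1 else 0)"
    unfolding total_recursive_def
  proof (intro exI conjI allI)
    show "eval (PrimRec (Comp Succ [Zero]) Zero) [x] = Some (if x = 0 then 1 else 0)" for x
      by (induction x) auto
  qed auto
  have pos: "total_recursive (\<lambda>x. if x \<in> S then 1 else 0)"
    unfolding total_recursive_def
  proof (intro exI conjI allI)
    show "eval (PrimRec Zero (Comp Succ [Zero])) [x] = Some (if x \<in> S then 1 else 0)" for x
      by (induction x) (auto simp: S_def)
  qed auto
  show "computable_physical_model (S, A)"
    using zero test pos by (auto simp: A_def recursive_set_def)
  show "infinite S"
    unfolding S_def by (rule infinite_Ioi)
  have "restrict (\<lambda>x. 0) S = restrict (\<lambda>x. if x = 0 then 1 else 0 :: nat) S"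
    by (auto simp: S_def restrict_def)
  moreover have "(\<lambda>x::nat. 0) \<noteq> (\<lambda>x. if x = 0 then 1 else 0 :: nat)"
    by (metis zero_neq_one)
  ultimately have "\<not> separated_by_states S A"
    unfolding A_def inj_on_def by blast
  then show "\<nexists>B. isomorphic (S, A) (UNIV, B)"
    using isomorphic_UNIV_imp_separated by blast
qed

end

(* Precomposing every observable with a recursive bijection e from the new states onto S gives an
   isomorphic computable model, provided this precomposition is injective on observables. If S is
   infinite, e enumerates S in increasing order, the next element being found by minimisation. If S
   is finite, e lists S on {0..<n} and is continued by n + x |-> x, so that e is onto the
   non-negative integers and no observable is identified with another, even if the two agree on S. *)

theory Submission
  imports Defs "HOL-Library.Infinite_Set"
begin

lemma total_recursive_comp:
  assumes "total_recursive f" "total_recursive g"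
  shows "total_recursive (f \<circ> g)"
proof -
  obtain p q where "has_arity 1 p" "\<And>x. eval p [x] = Some (f x)"
    "has_arity 1 q" "\<And>x. eval q [x] = Some (g x)"
    using assms unfolding total_recursive_def by blast
  then show ?thesis
    unfolding total_recursive_def by (intro exI[of _ "Comp p [q]"]) auto
qed

lemma total_recursive_id: "total_recursive (\<lambda>x. x)"
  unfolding total_recursive_def by (rule exI[of _ "Proj 0"]) simp

lemma recursive_set_UNIV: "recursive_set UNIV"
  unfolding recursive_set_def total_recursive_def
  by (rule exI[of _ "Comp Succ [Zero]"]) simp

lemma ex_recf_const: "\<exists>p. has_arity k p \<and> (\<forall>xs. eval p xs = Some c)"
proof (induction c)
  case 0
  show ?case by (rule exI[of _ Zero]) simp
next
  case (Suc c)
  then obtain p where "has_arity k p" "\<And>xs. eval p xs = Some c" by blast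
  then show ?case by (intro exI[of _ "Comp Succ [p]"]) auto
qed

text \<open>A case distinction is a primitive recursion whose step ignores the recursive value:
  \<open>Proj 0\<close> reads the predecessor only. The base case has arity 0, so the constant
  \<open>c\<close> is needed as a term of that arity.\<close>

lemma total_recursive_case_nat:
  assumes "total_recursive f"
  shows "total_recursive (case_nat c f)"
proof -
  obtain p q where p: "has_arity 1 p" "\<And>x. eval p [x] = Some (f x)"
    and q: "has_arity 0 q" "\<And>xs. eval q xs = Some c"
    using assms ex_recf_const[of 0 c] unfolding total_recursive_def by blast
  have "eval (PrimRec q (Comp p [Proj 0])) [x] = Some (case_nat c f x)" for x
    by (induction x) (auto simp: p q)
  then show ?thesis
    unfolding total_recursive_def using p q
    by (intro exI[of _ "PrimRec q (Comp p [Proj 0])"]) auto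
qed

text \<open>Each entry of \<open>xs\<close> costs one \<open>case_nat\<close>. This handles the
  characteristic function of an initial segment as well as the listing of a finite
  \<open>S\<close>.\<close>

lemma total_recursive_prepend:
  assumes "total_recursive f"
  shows "total_recursive (\<lambda>x. if x < length xs then xs ! x else f (x - length xs))"
proof (induction xs)
  case Nil
  show ?case using assms by simp
next
  case (Cons a xs)
  have "(\<lambda>x. if x < length (a # xs) then (a # xs) ! x else f (x - length (a # xs))) =
    case_nat a (\<lambda>x. if x < length xs then xs ! x else f (x - length xs))"
    by (auto split: nat.split)
  then show ?case using total_recursive_case_nat[OF Cons.IH] by simp
qed

lemma recursive_set_lessThan: "recursive_set {..<n}"
proof -
  have "total_recursive (\<lambda>x. 0)"
    unfolding total_recursive_def by (rule exI[of _ Zero]) simp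
  \<comment> \<open>The characteristic function of \<open>{..<n}\<close> is a list of
    \<open>n\<close> ones continued by the zero function.\<close>
  then have "total_recursive
      (\<lambda>x. if x < length (replicate n 1) then replicate n 1 ! x else (0::nat))"
    using total_recursive_prepend[of "\<lambda>x. 0" "replicate n 1"] by simp
  moreover have "(\<lambda>x. if x < length (replicate n 1) then replicate n 1 ! x else (0::nat)) =
      (\<lambda>x. if x \<in> {..<n} then 1 else 0)"
    by auto
  ultimately show ?thesis
    unfolding recursive_set_def by simp
qed

text \<open>Minimisation runs over the offset \<open>z\<close> with \<open>z + r\<close> in
  \<open>S\<close>, which builds in the bound from below; adding \<open>r\<close> to the least
  offset gives the value.\<close>

lemma total_recursive_least_above:
  assumes "recursive_set S" "infinite S"
  shows "total_recursive (\<lambda>r. LEAST x. x \<in> S \<and> r \<le> x)"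
proof -
  obtain p where p: "has_arity 1 p" "\<And>x. eval p [x] = Some (if x \<in> S then 1 else 0)"
    using assms(1) unfolding recursive_set_def total_recursive_def by blast
  define add where "add = PrimRec (Proj 0) (Comp Succ [Proj 1])"
  \<comment> \<open>\<open>Mu\<close> searches for a zero, so the outer \<open>PrimRec\<close> swaps
    the values 0 and 1 of the characteristic function.\<close>
  define test where "test = Comp (PrimRec (Comp Succ [Zero]) Zero) [Comp p [add]]"
  define nxt where "nxt = Comp add [Mu test, Proj 0]"
  have add: "eval add [a, b] = Some (a + b)" for a b
    unfolding add_def by (induction a) auto
  have test: "eval test [z, r] = Some (if z + r \<in> S then 0 else 1)" for z r
    by (simp add: test_def add p)
  have "eval nxt [r] = Some (LEAST x. x \<in> S \<and> r \<le> x)" for r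
  proof -
    \<comment> \<open>Infinity of \<open>S\<close> makes the search succeed for every
      \<open>r\<close>; the convergence that \<open>Mu\<close> demands below the first zero holds
      because \<open>test\<close> converges everywhere.\<close>
    obtain x where "x \<in> S" "r \<le> x"
      using assms(2) infinite_nat_iff_unbounded_le by blast
    then have ex: "\<exists>z. z + r \<in> S"
      by (metis le_add_diff_inverse2)
    then have "eval (Mu test) [r] = Some (LEAST z. z + r \<in> S)"
      by (simp add: test)
    then have "eval nxt [r] = Some ((LEAST z. z + r \<in> S) + r)"
      by (simp add: nxt_def add del: eval.simps(6))
    moreover have "(LEAST x. x \<in> S \<and> r \<le> x) = (LEAST z. z + r \<in> S) + r"
    proof (rule Least_equality)
      show "(LEAST z. z + r \<in> S) + r \<in> S \<and> r \<le> (LEAST z. z + r \<in> S) + r"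
        using LeastI_ex[OF ex] by simp
      fix y assume y: "y \<in> S \<and> r \<le> y"
      then have "(LEAST z. z + r \<in> S) \<le> y - r"
        by (intro Least_le) simp
      with y show "(LEAST z. z + r \<in> S) + r \<le> y" by linarith
    qed
    ultimately show ?thesis by simp
  qed
  moreover have "has_arity 1 nxt"
    using p(1) by (simp add: nxt_def test_def add_def)
  ultimately show ?thesis
    unfolding total_recursive_def by blast
qed

lemma total_recursive_enumerate:
  assumes "recursive_set S" "infinite S"
  shows "total_recursive (enumerate S)"
proof -
  obtain p where p: "has_arity 1 p" "\<And>r. eval p [r] = Some (LEAST x. x \<in> S \<and> r \<le> x)"
    using total_recursive_least_above[OF assms] unfolding total_recursive_def by blast
  \<comment> \<open>\<open>Proj 1\<close> is the previous element; its successor as lower bound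
    makes the next one strictly larger.\<close>
  define e where "e = PrimRec (Comp p [Zero]) (Comp p [Comp Succ [Proj 1]])"
  have "eval e [n] = Some (enumerate S n)" for n
  proof (induction n)
    case 0
    show ?case by (simp add: e_def p enumerate_0)
  next
    case (Suc n)
    then show ?case
      by (simp add: e_def p enumerate_Suc''[OF assms(2)] Suc_le_eq)
  qed
  moreover have "has_arity 1 e"
    using p(1) by (simp add: e_def)
  ultimately show ?thesis
    unfolding total_recursive_def by blast
qed

text \<open>States are carried over by the inverse of \<open>e\<close>, and the two cancel in
  \<open>\<alpha> (e (inv_into T e s))\<close>.\<close>

lemma isomorphic_precomp:
  assumes e: "bij_betw e T S" and "inj_on (\<lambda>\<alpha>. \<alpha> \<circ> e) A"
  shows "isomorphic (S, A) (T, (\<lambda>\<alpha>. \<alpha> \<circ> e) ` A)"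
proof -
  have "bij_betw (\<lambda>\<alpha>. \<alpha> \<circ> e) A ((\<lambda>\<alpha>. \<alpha> \<circ> e) ` A)"
    using assms(2) by (rule inj_on_imp_bij_betw)
  moreover have "\<forall>s\<in>S. \<forall>\<alpha>\<in>A. \<alpha> s = (\<alpha> \<circ> e) (inv_into T e s)"
    by (simp add: bij_betw_inv_into_right[OF e])
  ultimately show ?thesis
    using bij_betw_inv_into[OF e] unfolding isomorphic.simps by blast
qed

lemma computable_physical_model_precomp:
  assumes "computable_physical_model (S, A)" "recursive_set T" "total_recursive e"
  shows "computable_physical_model (T, (\<lambda>\<alpha>. \<alpha> \<circ> e) ` A)"
  using assms by (auto intro: total_recursive_comp)

text \<open>The composite with \<open>e\<close> determines an observable on the range of
  \<open>e\<close>, and separation determines it elsewhere.\<close>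

lemma inj_on_precomp_if_separated:
  assumes "range e = S" "separated_by_states S A"
  shows "inj_on (\<lambda>\<alpha>. \<alpha> \<circ> e) A"
proof (rule inj_onI)
  fix \<alpha> \<beta> assume "\<alpha> \<in> A" "\<beta> \<in> A" and "\<alpha> \<circ> e = \<beta> \<circ> e"
  moreover from this have "restrict \<alpha> S = restrict \<beta> S"
    using assms(1) by (auto simp: restrict_def fun_eq_iff)
  ultimately show "\<alpha> = \<beta>"
    using assms(2) by (auto dest: inj_onD)
qed

lemma infinite_model:
  assumes model: "computable_physical_model (S, A)" and "infinite S"
  shows "\<exists>B. computable_physical_model (UNIV, B)
    \<and> isomorphic (S, observables_on S A) (UNIV, B)
    \<and> (separated_by_states S A \<longrightarrow> isomorphic (S, A) (UNIV, B))"
proof -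
  define e where "e = enumerate S"
  define B where "B = (\<lambda>\<alpha>. \<alpha> \<circ> e) ` A"
  have e: "bij_betw e UNIV S"
    unfolding e_def using assms(2) by (rule bij_enumerate)
  then have range: "range e = S"
    by (rule bij_betw_imp_surj_on)
  have "computable_physical_model (UNIV, B)"
    unfolding B_def e_def using assms
    by (intro computable_physical_model_precomp[OF model] recursive_set_UNIV
        total_recursive_enumerate) auto
  moreover have "isomorphic (S, observables_on S A) (UNIV, B)"
  proof -
    have "separated_by_states S (observables_on S A)"
      by (auto intro!: inj_onI)
    then have "isomorphic (S, observables_on S A) (UNIV, (\<lambda>\<alpha>. \<alpha> \<circ> e) ` observables_on S A)"
      by (intro isomorphic_precomp e inj_on_precomp_if_separated[OF range])
    \<comment> \<open>All values of \<open>e\<close> lie in \<open>S\<close>, so precomposition does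
      not see the restriction and the same \<open>B\<close> serves both isomorphisms.\<close>
    moreover have "restrict \<alpha> S \<circ> e = \<alpha> \<circ> e" for \<alpha> :: "nat \<Rightarrow> nat"
      using range by (auto simp: fun_eq_iff)
    ultimately show ?thesis
      by (simp add: B_def image_image del: isomorphic.simps)
  qed
  moreover have "isomorphic (S, A) (UNIV, B)" if "separated_by_states S A"
    unfolding B_def using that
    by (intro isomorphic_precomp e inj_on_precomp_if_separated[OF range])
  ultimately show ?thesis by blast
qed

lemma finite_model:
  assumes model: "computable_physical_model (S, A)" and "finite S"
  shows "\<exists>B. computable_physical_model ({..<card S}, B) \<and> isomorphic (S, A) ({..<card S}, B)"
proof -
  obtain xs where xs: "set xs = S" "distinct xs"
    using finite_distinct_list[OF assms(2)] by blast
  then have len: "length xs = card S"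
    by (metis distinct_card)
  define e where "e = (\<lambda>x. if x < length xs then xs ! x else x - length xs)"
  define B where "B = (\<lambda>\<alpha>. \<alpha> \<circ> e) ` A"
  have "bij_betw ((!) xs) {..<card S} S"
    using xs len by (intro bij_betw_nth) auto
  then have e: "bij_betw e {..<card S} S"
    by (rule bij_betw_cong[THEN iffD1, rotated]) (simp add: e_def len)
  \<comment> \<open>The tail of \<open>e\<close> alone already takes every value, so separation is
    required only on \<open>UNIV\<close>, where it is trivial.\<close>
  have "e (y + length xs) = y" for y
    by (simp add: e_def)
  then have "range e = UNIV"
    by (rule surjI)
  then have "inj_on (\<lambda>\<alpha>. \<alpha> \<circ> e) A"
    by (rule inj_on_precomp_if_separated) (simp add: restrict_UNIV)
  then have "isomorphic (S, A) ({..<card S}, B)"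
    unfolding B_def using e by (intro isomorphic_precomp)
  moreover have "computable_physical_model ({..<card S}, B)"
    unfolding B_def e_def
    by (intro computable_physical_model_precomp[OF model] recursive_set_lessThan
        total_recursive_prepend total_recursive_id)
  ultimately show ?thesis by blast
qed

theorem theorem2:
  fixes S :: "nat set" and A :: "(nat \<Rightarrow> nat) set"
  assumes "computable_physical_model (S, A)"
  shows "(infinite S \<longrightarrow>
            (\<exists>B. computable_physical_model (UNIV, B)
               \<and> isomorphic (S, observables_on S A) (UNIV, B)
               \<and> (separated_by_states S A \<longrightarrow> isomorphic (S, A) (UNIV, B))))
       \<and> (\<forall>n. finite S \<and> card S = n \<longrightarrow>
            (\<exists>B. computable_physical_model ({..<n}, B) \<and> isomorphic (S, A) ({..<n}, B)))"
  using infinite_model[OF assms] finite_model[OF assms] by blast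

end
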